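(* Let $n\ge 1$, let $m\ge 2$ be even, let $p$ be a divisor of $m$, and let $G=G(m,p,n)\subset\mathbb G_n$. Then there exists a unique finite subgroup $\mu(G)\subset \mathbb G_n$ such that the restriction of the action $\triangleright_-$ (of $\mathbb G_n$ on $S(V)$) to $\mu(G)$ is mystically equivalent to the restriction of the action $\triangleright_+$ to $G$. In fact, $\mu(G)=W_{\mathcal C,\mathcal C'}$, where $\mathcal C$ and $\mathcal C'$ are the subgroups of $\mathbb C^\times$ with $|\mathcal C|=m$ and $|\mathcal C'|=\frac mp$.
   Context: $V$ is a complex vector space with basis $x_1,\dots,x_n$, and $S(V)$ is its symmetric algebra, with $\mathbb C$-basis the monomials $x_1^{k_1}\cdots x_n^{k_n}$, $k_i\in\mathbb Z_{\ge 0}$. $\mathbb G_n=(\mathbb C^\times)^n\rtimes\mathbb S_n\subset \mathrm{GL}_n(\mathbb C)=\mathrm{GL}(V)$ is the group of monomial matrices; here $(\mathbb C^\times)^n$ is the group of diagonal matrices and $\mathbb S_n$ the group of permutation matrices (permuting $x_1,\dots,x_n$). Every element of $\mathbb G_n$ is uniquely of the form $tw$ with $t\in(\mathbb C^\times)^n$, $w\in\mathbb S_n$. $\det$ denotes the restriction to $\mathbb G_n$ of the determinant of $\mathrm{GL}_n(\mathbb C)$. $\mathbb G_n$ is generated by $s_i\in\mathbb S_n$ ($1\le i\le n-1$), the permutation swapping $x_i$ and $x_{i+1}$, and $t_j^{(\zeta)}\in(\mathbb C^\times)^n$ ($1\le j\le n$, $\zeta\in\mathbb C^\times$), where $t_j^{(\zeta)}$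 maps $x_k$ to $\zeta^{\delta_{jk}}x_k$. The actions $\triangleright_+$ and $\triangleright_-$ are the unique faithful linear actions of $\mathbb G_n$ on the vector space $S(V)$ such that for all $i,j,\zeta$ $$s_i \triangleright_\pm x_1^{k_1}\cdots x_n^{k_n} = (\pm 1)^{k_ik_{i+1}} x_1^{k_1}\cdots x_i^{k_{i+1}}x_{i+1}^{k_i}\cdots x_n^{k_n},\qquad t_j^{(\zeta)}\triangleright_\pm x_1^{k_1}\cdots x_n^{k_n}=\zeta^{k_j}x_1^{k_1}\cdots x_n^{k_n}.$$ For finite subgroups $\mathcal C'\subseteq\mathcal C$ of $\mathbb C^\times$ of orders $\frac mp$ and $m$ respectively, $$G(m,p,n)=\{tw\in\mathcal C^n\rtimes\mathbb S_n:\det t\in\mathcal C'\},\qquad W_{\mathcal C,\mathcal C'}=\{tw\in\mathcal C^n\rtimes\mathbb S_n:\det(tw)\in\mathcal C'\}.$$ Mystical equivalence: let $G$, $G'$ be finite groups acting faithfully (and linearly) on a complex vector space $\mathcal V$, with corresponding algebra homomorphisms $\rho:\mathbb CG\to\mathrm{End}_{\mathbb C}\mathcal V$, $\rho':\mathbb CG'\to\mathrm{End}_{\mathbb C}\mathcal V$. The two actions are mystically equivalent if $\rho(e_G)=\rho'(e_{G'})$, where $e_G=\sum_{g\in G}g\in\mathbb CG$ and $e_{G'}=\sum_{g\in G'}g\in\mathbb CG'$. *)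

theory Defs
  imports
    "HOL-Analysis.Analysis"
    "HOL-Algebra.Coset"
    "HOL-Library.Poly_Mapping"
    "HOL-Combinatorics.Transposition"
begin

section \<open>Faithful linear actions and mystical equivalence\<close>

definition faithful_linear_action ::
    "(complex \<Rightarrow> 'v \<Rightarrow> 'v::ab_group_add) \<Rightarrow> ('g, 'r) monoid_scheme \<Rightarrow> ('g \<Rightarrow> 'v \<Rightarrow> 'v) \<Rightarrow> bool" where
  "faithful_linear_action s G \<rho> \<longleftrightarrow>
     vector_space s \<and> group G \<and>
     (\<forall>g \<in> carrier G. Vector_Spaces.linear s s (\<rho> g)) \<and>
     \<rho> \<one>\<^bsub>G\<^esub> = id \<and>
     (\<forall>g \<in> carrier G. \<forall>h \<in> carrier G. \<rho> (g \<otimes>\<^bsub>G\<^esub> h) = \<rho> g \<circ> \<rho> h) \<and>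
     inj_on \<rho> (carrier G)"

text \<open>For a finite group, elements of the group algebra are coefficient functions on the carrier;
  this is the linear extension of an action to the group algebra.\<close>

definition algebra_hom ::
    "(complex \<Rightarrow> 'v \<Rightarrow> 'v::ab_group_add) \<Rightarrow> ('g, 'r) monoid_scheme \<Rightarrow> ('g \<Rightarrow> 'v \<Rightarrow> 'v)
      \<Rightarrow> ('g \<Rightarrow> complex) \<Rightarrow> 'v \<Rightarrow> 'v" where
  "algebra_hom s G \<rho> a = (\<lambda>v. \<Sum>g \<in> carrier G. s (a g) (\<rho> g v))"

definition group_sum :: "('g, 'r) monoid_scheme \<Rightarrow> 'g \<Rightarrow> complex" where
  "group_sum G = indicator (carrier G)"

definition mystically_equivalent ::
    "(complex \<Rightarrow> 'v \<Rightarrow> 'v::ab_group_add) \<Rightarrow> ('g, 'r) monoid_scheme \<Rightarrow> ('g \<Rightarrow> 'v \<Rightarrow> 'v)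
      \<Rightarrow> ('h, 'q) monoid_scheme \<Rightarrow> ('h \<Rightarrow> 'v \<Rightarrow> 'v) \<Rightarrow> bool" where
  "mystically_equivalent s G \<rho> G' \<rho>' \<longleftrightarrow>
     finite (carrier G) \<and> finite (carrier G') \<and>
     faithful_linear_action s G \<rho> \<and> faithful_linear_action s G' \<rho>' \<and>
     algebra_hom s G \<rho> (group_sum G) = algebra_hom s G' \<rho>' (group_sum G')"


section \<open>Monomial matrices\<close>

text \<open>The basis of the space \<open>V\<close> is indexed by a finite linearly ordered type \<open>'n\<close>, so that
  \<open>n = CARD('n)\<close>; a matrix sends the basis vector \<open>x\<^sub>k\<close> to its \<open>k\<close>-th column.\<close>

type_synonym 'n cmat = "((complex, 'n) vec, 'n) vec"

definition diag_mat :: "('n::finite \<Rightarrow> complex) \<Rightarrow> 'n cmat" where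
  "diag_mat t = (\<chi> i k. if i = k then t i else 0)"

definition perm_mat :: "('n::finite \<Rightarrow> 'n) \<Rightarrow> 'n cmat" where
  "perm_mat w = (\<chi> i k. if i = w k then 1 else 0)"

definition monomial_group :: "'n::finite cmat monoid" where
  "monomial_group = \<lparr>
     carrier = {diag_mat t ** perm_mat w | t w. (\<forall>i. t i \<noteq> 0) \<and> bij w},
     monoid.mult = (**),
     one = mat 1\<rparr>"

definition swap_mat :: "'n::finite \<Rightarrow> 'n \<Rightarrow> 'n cmat" where
  "swap_mat i j = perm_mat (Transposition.transpose i j)"

definition torus_mat :: "'n::finite \<Rightarrow> complex \<Rightarrow> 'n cmat" where
  "torus_mat j \<zeta> = diag_mat (\<lambda>i. if i = j then \<zeta> else 1)"

definition consecutive :: "'n::linorder \<Rightarrow> 'n \<Rightarrow> bool" where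
  "consecutive i j \<longleftrightarrow> i < j \<and> {i<..<j} = {}"


section \<open>The two actions on the symmetric algebra\<close>

text \<open>\<open>S(V)\<close> is the polynomial algebra on the \<open>x\<^sub>i\<close>: finitely supported functions from exponent
  vectors to \<open>\<complex>\<close>.\<close>

type_synonym 'n symalg = "('n \<Rightarrow>\<^sub>0 nat) \<Rightarrow>\<^sub>0 complex"

definition sscale :: "complex \<Rightarrow> 'n symalg \<Rightarrow> 'n symalg" where
  "sscale c = Poly_Mapping.map ((*) c)"

definition exp_monom :: "('n \<Rightarrow>\<^sub>0 nat) \<Rightarrow> 'n symalg" where
  "exp_monom k = Poly_Mapping.single k 1"

definition is_triangle_action ::
    "complex \<Rightarrow> (('n::{finite,linorder}) cmat \<Rightarrow> 'n symalg \<Rightarrow> 'n symalg) \<Rightarrow> bool" where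
  "is_triangle_action \<epsilon> act \<longleftrightarrow>
     faithful_linear_action sscale monomial_group act \<and>
     (\<forall>i j k. consecutive i j \<longrightarrow>
        act (swap_mat i j) (exp_monom k) =
          sscale (\<epsilon> ^ (Poly_Mapping.lookup k i * Poly_Mapping.lookup k j))
            (exp_monom (Poly_Mapping.map_key (Transposition.transpose i j) k))) \<and>
     (\<forall>j \<zeta> k. \<zeta> \<noteq> 0 \<longrightarrow>
        act (torus_mat j \<zeta>) (exp_monom k) = sscale (\<zeta> ^ Poly_Mapping.lookup k j) (exp_monom k))"

text \<open>Extensionality fixes the irrelevant values outside the monomial group. That the description
  is proper is proved below in \<open>triangle_action_ex1\<close>.\<close>

definition triangle_action ::
    "complex \<Rightarrow> ('n::{finite,linorder}) cmat \<Rightarrow> 'n symalg \<Rightarrow> 'n symalg" where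
  "triangle_action \<epsilon> =
     (THE act. is_triangle_action \<epsilon> act \<and> act \<in> extensional (carrier monomial_group))"

abbreviation triangle_plus (infixr \<open>\<triangleright>\<^sub>+\<close> 75) where
  "triangle_plus \<equiv> triangle_action 1"

abbreviation triangle_minus (infixr \<open>\<triangleright>\<^sub>-\<close> 75) where
  "triangle_minus \<equiv> triangle_action (-1)"


section \<open>The groups \<open>G(m,p,n)\<close> and \<open>W\<^bsub>C,C'\<^esub>\<close>\<close>

definition complex_units :: "complex monoid" where
  "complex_units = \<lparr>carrier = UNIV - {0}, monoid.mult = (*), one = 1\<rparr>"

text \<open>Here \<open>C\<close> and \<open>C'\<close> are the subgroups of the multiplicative group of orders \<open>m\<close> and \<open>m/p\<close>,
  so that the first set is \<open>G(m,p,n)\<close>.\<close>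

definition G_group :: "complex set \<Rightarrow> complex set \<Rightarrow> 'n::finite cmat set" where
  "G_group C C' = {diag_mat t ** perm_mat w | t w.
     (\<forall>i. t i \<in> C) \<and> bij w \<and> det (diag_mat t) \<in> C'}"

definition W_group :: "complex set \<Rightarrow> complex set \<Rightarrow> 'n::finite cmat set" where
  "W_group C C' = {diag_mat t ** perm_mat w | t w.
     (\<forall>i. t i \<in> C) \<and> bij w \<and> det (diag_mat t ** perm_mat w) \<in> C'}"

definition is_mystic_partner ::
    "('n::{finite,linorder}) cmat set \<Rightarrow> 'n cmat set \<Rightarrow> bool" where
  "is_mystic_partner G M \<longleftrightarrow>
     subgroup M monomial_group \<and> finite M \<and>
     mystically_equivalent sscale
       (monomial_group\<lparr>carrier := M\<rparr>) triangle_minus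
       (monomial_group\<lparr>carrier := G\<rparr>) triangle_plus"

definition mystic_partner ::
    "('n::{finite,linorder}) cmat set \<Rightarrow> 'n cmat set" where
  "mystic_partner G = (THE M. is_mystic_partner G M)"


section \<open>Existence and uniqueness of the actions\<close>

text \<open>The notation \<open>inv\<close> is taken by group inverses.\<close>

abbreviation (input) finv :: "('a \<Rightarrow> 'b) \<Rightarrow> 'b \<Rightarrow> 'a" where
  "finv \<equiv> inv_into UNIV"

definition mon_mat :: "('n::finite \<Rightarrow> complex) \<Rightarrow> ('n \<Rightarrow> 'n) \<Rightarrow> 'n cmat" where
  "mon_mat c w = (\<chi> i k. if i = w k then c k else 0)"

lemma diag_perm_mat: "diag_mat t ** perm_mat w = mon_mat (t \<circ> w) w"
proof -
  have *: "(if i = k then t i else 0) * (if k = w j then 1 else 0) = (if k = i then if i = w j then t i else 0 else 0)"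
    for i j k by auto
  show ?thesis
    unfolding mon_mat_def diag_mat_def perm_mat_def matrix_matrix_mult_def
    by (simp add: vec_eq_iff * )
qed

lemma perm_mat_eq: "perm_mat w = mon_mat (\<lambda>_. 1) w"
  unfolding perm_mat_def mon_mat_def by simp

lemma diag_mat_eq: "diag_mat t = mon_mat t id"
  unfolding diag_mat_def mon_mat_def by (auto simp: vec_eq_iff)

lemma mat_1_eq: "mat 1 = mon_mat (\<lambda>_. 1) id"
  unfolding mat_def mon_mat_def by (auto simp: vec_eq_iff)

lemma mon_mat_mult: "mon_mat c w ** mon_mat d v = mon_mat (\<lambda>j. c (v j) * d j) (w \<circ> v)"
proof -
  have *: "(if i = w k then c k else 0) * (if k = v j then d j else 0)
      = (if k = v j then if i = w (v j) then c (v j) * d j else 0 else 0)" for i j k by auto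
  show ?thesis
    unfolding mon_mat_def matrix_matrix_mult_def by (simp add: vec_eq_iff * )
qed

lemma carrier_monomial_group:
  "carrier monomial_group = {mon_mat c w | c w. (\<forall>i. c i \<noteq> 0) \<and> bij w}"
proof safe
  fix x :: "'a cmat" assume "x \<in> carrier monomial_group"
  then obtain t w where "x = diag_mat t ** perm_mat w" "\<forall>i. t i \<noteq> 0" "bij w"
    by (auto simp: monomial_group_def)
  then show "\<exists>c w. x = mon_mat c w \<and> (\<forall>i. c i \<noteq> 0) \<and> bij w"
    by (intro exI[of _ "t \<circ> w"] exI[of _ w]) (auto simp: diag_perm_mat)
next
  fix c :: "'a \<Rightarrow> complex" and w :: "'a \<Rightarrow> 'a" assume *: "\<forall>i. c i \<noteq> 0" "bij w"
  have "c \<circ> finv w \<circ> w = c" using *(2) by (simp add: fun_eq_iff bij_is_inj)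
  then have "mon_mat c w = diag_mat (c \<circ> finv w) ** perm_mat w"
    by (simp add: diag_perm_mat)
  then show "mon_mat c w \<in> carrier monomial_group"
    using * unfolding monomial_group_def by (auto intro!: exI[of _ "c \<circ> finv w"])
qed

lemma mult_monomial_group [simp]: "x \<otimes>\<^bsub>monomial_group\<^esub> y = x ** y"
  and one_monomial_group [simp]: "\<one>\<^bsub>monomial_group\<^esub> = mat 1"
  by (simp_all add: monomial_group_def)

lemma group_monomial_group: "group monomial_group"
proof (rule groupI)
  fix x y :: "'a cmat" assume "x \<in> carrier monomial_group" "y \<in> carrier monomial_group"
  then show "x \<otimes>\<^bsub>monomial_group\<^esub> y \<in> carrier monomial_group"
    unfolding carrier_monomial_group mult_monomial_group
    by (fastforce simp: mon_mat_mult intro: bij_comp)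
next
  show "\<one>\<^bsub>monomial_group\<^esub> \<in> carrier monomial_group"
    unfolding carrier_monomial_group by (auto simp: mat_1_eq intro!: exI bij_id)
next
  fix x :: "'a cmat" assume "x \<in> carrier monomial_group"
  then obtain c w where x: "x = mon_mat c w" "\<forall>i. c i \<noteq> 0" "bij w"
    unfolding carrier_monomial_group by auto
  have "mon_mat (\<lambda>j. 1 / c (finv w j)) (finv w) ** x = mat 1"
    using x by (simp add: mon_mat_mult mat_1_eq bij_is_inj)
  moreover have "mon_mat (\<lambda>j. 1 / c (finv w j)) (finv w) \<in> carrier monomial_group"
    using x unfolding carrier_monomial_group by (auto intro!: exI bij_imp_bij_inv)
  ultimately show "\<exists>y\<in>carrier monomial_group. y \<otimes>\<^bsub>monomial_group\<^esub> x = \<one>\<^bsub>monomial_group\<^esub>"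
    by auto
qed (auto simp: matrix_mul_assoc)


lemma lookup_sscale [simp]: "Poly_Mapping.lookup (sscale c p) k = c * Poly_Mapping.lookup p k"
  unfolding sscale_def by (simp add: Poly_Mapping.map.rep_eq when_def)

lemma vector_space_sscale: "vector_space sscale"
  by unfold_locales (auto intro!: poly_mapping_eqI simp: lookup_add algebra_simps)

lemma linear_sscaleI:
  assumes "\<And>p q. f (p + q) = f p + f q" "\<And>c p. f (sscale c p) = sscale c (f p)"
  shows "Vector_Spaces.linear sscale sscale f"
proof -
  interpret vector_space sscale by (rule vector_space_sscale)
  show ?thesis by unfold_locales (fact assms)+
qed

lemma symalg_expand:
  "p = (\<Sum>k \<in> Poly_Mapping.keys p. sscale (Poly_Mapping.lookup p k) (exp_monom k))"
proof (rule poly_mapping_eqI)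
  fix k
  show "Poly_Mapping.lookup p k = Poly_Mapping.lookup (\<Sum>k \<in> Poly_Mapping.keys p. sscale (Poly_Mapping.lookup p k) (exp_monom k)) k"
    by (simp add: lookup_sum exp_monom_def lookup_single when_def if_distrib in_keys_iff sum.delta cong: if_cong)
qed

lemma linear_sscale_sum:
  assumes "Vector_Spaces.linear sscale sscale f"
  shows "f (\<Sum>k\<in>A. sscale (a k) (b k)) = (\<Sum>k\<in>A. sscale (a k) (f (b k)))"
proof -
  interpret f: Vector_Spaces.linear sscale sscale f by fact
  show ?thesis by (simp add: f.sum f.scale)
qed

lemma linear_eq_on_monom:
  assumes f: "Vector_Spaces.linear sscale sscale f" and g: "Vector_Spaces.linear sscale sscale g"
    and eq: "\<And>k. f (exp_monom k) = g (exp_monom k)"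
  shows "f = g"
proof
  fix p
  show "f p = g p"
    by (subst (1 2) symalg_expand[of p])
       (simp add: linear_sscale_sum[OF f] linear_sscale_sum[OF g] eq)
qed

definition lin_ext :: "(('n \<Rightarrow>\<^sub>0 nat) \<Rightarrow> 'n symalg) \<Rightarrow> 'n symalg \<Rightarrow> 'n symalg" where
  "lin_ext b p = (\<Sum>k \<in> Poly_Mapping.keys p. sscale (Poly_Mapping.lookup p k) (b k))"

lemma lin_ext_superset:
  assumes "finite A" "Poly_Mapping.keys p \<subseteq> A"
  shows "lin_ext b p = (\<Sum>k \<in> A. sscale (Poly_Mapping.lookup p k) (b k))"
  unfolding lin_ext_def using assms
  by (intro sum.mono_neutral_left) (auto simp: in_keys_iff intro!: poly_mapping_eqI)

lemma linear_lin_ext: "Vector_Spaces.linear sscale sscale (lin_ext b)"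
proof (rule linear_sscaleI)
  interpret vector_space sscale by (rule vector_space_sscale)
  fix p q :: "'a symalg"
  let ?A = "Poly_Mapping.keys p \<union> Poly_Mapping.keys q"
  have "Poly_Mapping.keys (p + q) \<subseteq> ?A" by (rule keys_add)
  then show "lin_ext b (p + q) = lin_ext b p + lin_ext b q"
    by (simp add: lin_ext_superset[of ?A] lookup_add scale_left_distrib sum.distrib)
next
  interpret vector_space sscale by (rule vector_space_sscale)
  fix c and p :: "'a symalg"
  have "Poly_Mapping.keys (sscale c p) \<subseteq> Poly_Mapping.keys p" by (auto simp: in_keys_iff)
  then show "lin_ext b (sscale c p) = sscale c (lin_ext b p)"
    by (simp add: lin_ext_superset[of "Poly_Mapping.keys p"] scale_sum_right)
qed

lemma lin_ext_monom [simp]: "lin_ext b (exp_monom k) = b k"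
  unfolding lin_ext_def exp_monom_def by (auto intro!: poly_mapping_eqI)


subsection \<open>The explicit formula\<close>

definition perm_exp :: "('n \<Rightarrow> 'n) \<Rightarrow> ('n \<Rightarrow>\<^sub>0 nat) \<Rightarrow> ('n \<Rightarrow>\<^sub>0 nat)" where
  "perm_exp w k = Poly_Mapping.map_key (finv w) k"

lemma lookup_perm_exp: "bij w \<Longrightarrow> Poly_Mapping.lookup (perm_exp w k) a = Poly_Mapping.lookup k (finv w a)"
  unfolding perm_exp_def by (subst Poly_Mapping.map_key.rep_eq) (auto intro: bij_is_inj bij_imp_bij_inv)

definition inv_sign :: "complex \<Rightarrow> ('n::{finite,linorder} \<Rightarrow> 'n) \<Rightarrow> ('n \<Rightarrow>\<^sub>0 nat) \<Rightarrow> complex" where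
  "inv_sign \<epsilon> w k = (\<Prod>(a, b) \<in> {(a, b). a < b}.
     if w b < w a then \<epsilon> ^ (Poly_Mapping.lookup k a * Poly_Mapping.lookup k b) else 1)"

lemma prod_pairs_reindex:
  fixes h :: "'n::{finite,linorder} \<Rightarrow> 'n \<Rightarrow> complex" and w :: "'n \<Rightarrow> 'n"
  assumes w: "bij w" and sym: "\<And>a b. h a b = h b a"
  shows "(\<Prod>(a, b) \<in> {(a, b). a < b}. h (w a) (w b)) = (\<Prod>(a, b) \<in> {(a, b). a < b}. h a b)"
proof (rule prod.reindex_bij_witness[where
      i = "\<lambda>(c, d). (min (finv w c) (finv w d), max (finv w c) (finv w d))" and
      j = "\<lambda>(a, b). (min (w a) (w b), max (w a) (w b))"], goal_cases)
  case (1 x)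
  obtain a b where x: "x = (a, b)" "a < b" using 1 by auto
  then have le: "a \<le> b" "\<not> b \<le> a" by (auto intro: less_imp_le simp: not_le)
  have *: "finv w (w z) = z" for z using w by (simp add: bij_is_inj)
  show ?case
  proof (cases "w a \<le> w b")
    case True
    with x le show ?thesis by (simp add: min_def max_def * )
  next
    case False
    with x le show ?thesis by (simp add: min_def max_def * )
  qed
next
  case (2 x)
  have "w (fst x) \<noteq> w (snd x)" using 2 w by (auto simp: bij_def inj_eq)
  with 2 show ?case by (auto simp: min_def max_def)
next
  case (3 x)
  obtain c d where x: "x = (c, d)" "c < d" using 3 by auto
  then have le: "c \<le> d" "\<not> d \<le> c" by (auto intro: less_imp_le simp: not_le)
  have *: "w (finv w z) = z" for z using w by (simp add: bij_is_surj surj_f_inv_f)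
  show ?case
  proof (cases "finv w c \<le> finv w d")
    case True
    with x le show ?thesis by (simp add: min_def max_def * )
  next
    case False
    with x le show ?thesis by (simp add: min_def max_def * )
  qed
next
  case (4 x)
  have "finv w (fst x) \<noteq> finv w (snd x)" using 4 bij_imp_bij_inv[OF w] by (auto simp: bij_def inj_eq)
  with 4 show ?case by (auto simp: min_def max_def)
next
  case (5 x) then show ?case using sym by (auto simp: min_def max_def)
qed

lemma inv_sign_comp:
  assumes v: "bij v" and w: "bij w" and e: "\<epsilon>\<^sup>2 = 1"
  shows "inv_sign \<epsilon> (v \<circ> w) k = inv_sign \<epsilon> v (perm_exp w k) * inv_sign \<epsilon> w k"
proof -
  define l where "l = Poly_Mapping.lookup k"
  define e where "e = (\<lambda>a b. \<epsilon> ^ (l a * l b))"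
  have e1: "e a b * e a b = 1" for a b
    using e by (simp add: e_def flip: power2_eq_square power_mult) (metis mult.commute power_mult power_one)
  have es: "e a b = e b a" for a b by (simp add: e_def mult.commute)
  define h where "h = (\<lambda>u (a::'a) b. if (a < b) \<noteq> (u a < (u b :: 'a)) then e a b else 1)"
  define hv where "hv = (\<lambda>a b. if (a < b) \<noteq> (v a < v b) then e (finv w a) (finv w b) else 1)"
  have ne: "w a \<noteq> w b" "v (w a) \<noteq> v (w b)" if "a < b" for a b 
    using v w that by (metis bij_pointE less_irrefl)+
  have hvs: "hv a b = hv b a" for a b
  proof -
    have "v a = v b \<longleftrightarrow> a = b" using v by (metis bij_pointE)
    then show ?thesis unfolding hv_def using es by (cases "a = b") (auto simp: not_less le_less)
  qed
  have pair: "(if v (w b) < v (w a) then e a b else 1) = hv (w a) (w b) * h w a b" if "a < b" for a b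
  proof -
    have fw: "finv w (w z) = z" for z using w by (simp add: bij_is_inj)
    show ?thesis
      using that ne[OF that]
      by (cases "w a < w b"; cases "v (w a) < v (w b)") (simp_all add: hv_def h_def fw e1)
  qed
  have "inv_sign \<epsilon> (v \<circ> w) k = (\<Prod>(a, b) \<in> {(a, b). a < b}. if v (w b) < v (w a) then e a b else 1)"
    unfolding inv_sign_def l_def e_def comp_def ..
  also have "\<dots> = (\<Prod>(a, b) \<in> {(a, b). a < b}. hv (w a) (w b) * h w a b)"
    by (rule prod.cong[OF refl]) (use pair in force)
  also have "\<dots> = (\<Prod>(a, b) \<in> {(a, b). a < b}. hv (w a) (w b)) * (\<Prod>(a, b) \<in> {(a, b). a < b}. h w a b)"
    by (simp add: prod.distrib case_prod_beta)
  also have "(\<Prod>(a, b) \<in> {(a, b). a < b}. hv (w a) (w b)) = (\<Prod>(a, b) \<in> {(a, b). a < b}. hv a b)"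
    by (rule prod_pairs_reindex[OF w hvs])
  also have "\<dots> = inv_sign \<epsilon> v (perm_exp w k)"
  proof -
    have "hv a b = (if v b < v a then e (finv w a) (finv w b) else 1)" if "a < b" for a b
    proof -
      have "v a \<noteq> v b" using v that by (metis bij_pointE less_irrefl)
      with that show ?thesis by (cases "v a < v b") (simp_all add: hv_def)
    qed
    then show ?thesis unfolding inv_sign_def
      by (intro prod.cong refl) (auto simp: e_def l_def lookup_perm_exp[OF w])
  qed
  also have "(\<Prod>(a, b) \<in> {(a, b). a < b}. h w a b) = inv_sign \<epsilon> w k"
  proof -
    have "h w a b = (if w b < w a then e a b else 1)" if "a < b" for a b
      using that ne(1)[OF that] by (cases "w a < w b") (simp_all add: h_def)
    then show ?thesis unfolding inv_sign_def
      by (intro prod.cong refl) (auto simp: e_def l_def)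
  qed
  finally show ?thesis .
qed

lemma inv_sign_id [simp]: "inv_sign \<epsilon> id k = 1"
  unfolding inv_sign_def by (auto intro!: prod.neutral)

lemma transpose_consecutive_less:
  assumes "consecutive i j" "a < b"
  shows "Transposition.transpose i j b < Transposition.transpose i j a \<longleftrightarrow> a = i \<and> b = j"
proof -
  have ij: "i < j" and btw: "a \<le> i \<or> j \<le> a" for a
    using assms unfolding consecutive_def by (auto simp: set_eq_iff not_less)
  show ?thesis
    using assms(2) ij btw[of a] btw[of b] by (auto simp: Transposition.transpose_def)
qed

lemma inv_sign_consecutive:
  assumes "consecutive i j"
  shows "inv_sign \<epsilon> (Transposition.transpose i j) k
    = \<epsilon> ^ (Poly_Mapping.lookup k i * Poly_Mapping.lookup k j)"
proof -
  have ij: "i < j" and btw: "\<And>a. \<not> (i < a \<and> a < j)" using assms unfolding consecutive_def by auto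
  have "inv_sign \<epsilon> (Transposition.transpose i j) k = (\<Prod>x \<in> {(a, b). a < b}.
      if x = (i, j) then \<epsilon> ^ (Poly_Mapping.lookup k i * Poly_Mapping.lookup k j) else 1)"
    unfolding inv_sign_def by (intro prod.cong refl) (auto simp: transpose_consecutive_less[OF assms] split: if_splits)
  then show ?thesis using ij by (simp add: prod.delta)
qed

definition mono_coeff :: "('n::finite \<Rightarrow> complex) \<Rightarrow> ('n \<Rightarrow>\<^sub>0 nat) \<Rightarrow> complex" where
  "mono_coeff c k = (\<Prod>a\<in>UNIV. c a ^ Poly_Mapping.lookup k a)"

definition col_entry :: "'n::finite cmat \<Rightarrow> 'n \<Rightarrow> complex" where
  "col_entry g a = (\<Sum>b\<in>UNIV. g $ b $ a)"

definition col_perm :: "'n::finite cmat \<Rightarrow> 'n \<Rightarrow> 'n" where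
  "col_perm g a = (THE b. g $ b $ a \<noteq> 0)"

lemma col_entry_mon_mat [simp]: "col_entry (mon_mat c w) = c"
  unfolding col_entry_def mon_mat_def by simp

lemma col_perm_mon_mat [simp]: "(\<forall>i. c i \<noteq> 0) \<Longrightarrow> col_perm (mon_mat c w) = w"
  unfolding col_perm_def mon_mat_def by auto

definition explicit_action ::
    "complex \<Rightarrow> ('n::{finite,linorder}) cmat \<Rightarrow> 'n symalg \<Rightarrow> 'n symalg" where
  "explicit_action \<epsilon> = (\<lambda>g \<in> carrier monomial_group.
     lin_ext (\<lambda>k. sscale (mono_coeff (col_entry g) k * inv_sign \<epsilon> (col_perm g) k)
       (exp_monom (perm_exp (col_perm g) k))))"

lemma mon_mat_carrier: "(\<forall>i. c i \<noteq> 0) \<Longrightarrow> bij w \<Longrightarrow> mon_mat c w \<in> carrier monomial_group"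
  unfolding carrier_monomial_group by auto

lemma explicit_action_monom:
  assumes "\<forall>i. c i \<noteq> 0" "bij w"
  shows "explicit_action \<epsilon> (mon_mat c w) (exp_monom k)
    = sscale (mono_coeff c k * inv_sign \<epsilon> w k) (exp_monom (perm_exp w k))"
  using assms by (simp add: explicit_action_def mon_mat_carrier)

lemma linear_explicit_action:
  "g \<in> carrier monomial_group \<Longrightarrow> Vector_Spaces.linear sscale sscale (explicit_action \<epsilon> g)"
  unfolding explicit_action_def by (simp add: linear_lin_ext)

lemma perm_exp_comp: "bij v \<Longrightarrow> bij w \<Longrightarrow> perm_exp (v \<circ> w) k = perm_exp v (perm_exp w k)"
  by (rule poly_mapping_eqI) (simp add: lookup_perm_exp bij_comp o_inv_distrib)

lemma mono_coeff_comp: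
  assumes "bij v"
  shows "mono_coeff (\<lambda>j. c (v j) * d j) k = mono_coeff c (perm_exp v k) * mono_coeff d k"
proof -
  have "mono_coeff c (perm_exp v k) = (\<Prod>a\<in>UNIV. c (v a) ^ Poly_Mapping.lookup k a)"
    unfolding mono_coeff_def using assms
    by (subst prod.reindex_bij_betw[symmetric, of v UNIV UNIV]) (simp_all add: lookup_perm_exp bij_is_inj)
  then show ?thesis by (simp add: mono_coeff_def power_mult_distrib prod.distrib)
qed

lemma is_triangle_action_explicit:
  assumes e: "\<epsilon>\<^sup>2 = 1"
  shows "is_triangle_action \<epsilon> (explicit_action \<epsilon> :: ('n::{finite,linorder}) cmat \<Rightarrow> _)"
  unfolding is_triangle_action_def faithful_linear_action_def
proof (intro conjI ballI allI impI vector_space_sscale group_monomial_group)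
  interpret vector_space sscale by (rule vector_space_sscale)
  let ?A = "explicit_action \<epsilon> :: 'n cmat \<Rightarrow> _"
  note [simp] = bij_comp
  show lin: "Vector_Spaces.linear sscale sscale (?A g)" if "g \<in> carrier monomial_group" for g
    using that by (rule linear_explicit_action)
  have "Vector_Spaces.linear sscale sscale (?A (mat 1))"
    by (rule lin) (metis group.is_monoid group_monomial_group monoid.one_closed one_monomial_group)
  moreover have "?A (mat 1) (exp_monom k) = id (exp_monom k)" for k
  proof -
    have "perm_exp id k = k" by (rule poly_mapping_eqI) (simp add: lookup_perm_exp)
    then show ?thesis by (simp add: mat_1_eq explicit_action_monom mono_coeff_def)
  qed
  ultimately show "?A \<one>\<^bsub>monomial_group\<^esub> = id"
    by (simp add: linear_eq_on_monom linear_id)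
  show "?A (g \<otimes>\<^bsub>monomial_group\<^esub> h) = ?A g \<circ> ?A h"
    if gh: "g \<in> carrier monomial_group" "h \<in> carrier monomial_group" for g h
  proof (rule linear_eq_on_monom)
    show "Vector_Spaces.linear sscale sscale (?A (g \<otimes>\<^bsub>monomial_group\<^esub> h))"
      using gh by (intro lin) (meson group.is_monoid group_monomial_group monoid.m_closed)
    show "Vector_Spaces.linear sscale sscale (?A g \<circ> ?A h)"
      using lin gh by (intro Vector_Spaces.linear_compose)
    from gh obtain c w d v where gh': "g = mon_mat c w" "h = mon_mat d v" "bij w" "bij v"
      "\<forall>i. c i \<noteq> 0" "\<forall>i. d i \<noteq> 0" unfolding carrier_monomial_group by auto
    interpret Ag: Vector_Spaces.linear sscale sscale "?A g" using gh by (intro lin)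
    fix k
    show "?A (g \<otimes>\<^bsub>monomial_group\<^esub> h) (exp_monom k) = (?A g \<circ> ?A h) (exp_monom k)"
      using gh' Ag.scale
      by (simp add: mon_mat_mult explicit_action_monom inv_sign_comp e perm_exp_comp
          mono_coeff_comp[where d = d] mult_ac(1) mult.left_commute)
  qed
  show "inj_on ?A (carrier monomial_group)"
  proof (rule inj_onI)
    fix g h :: "'n cmat" assume gh: "g \<in> carrier monomial_group" "h \<in> carrier monomial_group" "?A g = ?A h"
    have key: "g $ b $ a = Poly_Mapping.lookup (?A g (exp_monom (Poly_Mapping.single a 1))) (Poly_Mapping.single b 1)"
      if "g \<in> carrier monomial_group" for g :: "'n cmat" and a b
    proof -
      from that obtain c w where g: "g = mon_mat c w" "\<forall>i. c i \<noteq> 0" "bij w"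
        unfolding carrier_monomial_group by auto
      have 1: "mono_coeff c (Poly_Mapping.single a 1) = c a"
        unfolding mono_coeff_def by (simp add: lookup_single when_def if_distrib prod.delta cong: if_cong)
      have 2: "inv_sign \<epsilon> w (Poly_Mapping.single a 1) = 1"
        unfolding inv_sign_def by (auto intro!: prod.neutral simp: lookup_single when_def)
      have 3: "perm_exp w (Poly_Mapping.single a 1) = Poly_Mapping.single (w a) 1"
        using g by (intro poly_mapping_eqI) (auto simp: lookup_perm_exp lookup_single when_def bij_inv_eq_iff)
      have 4: "(Poly_Mapping.single (w a) 1 = Poly_Mapping.single b (1::nat)) \<longleftrightarrow> b = w a"
        by (metis lookup_single_eq lookup_single_not_eq zero_neq_one)
      have "Poly_Mapping.lookup (explicit_action \<epsilon> g (exp_monom (Poly_Mapping.single a 1)))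
          (Poly_Mapping.single b 1) = c a * (1 when b = w a)"
        unfolding g(1) explicit_action_monom[OF g(2,3)] 1 2 3
        by (simp add: exp_monom_def lookup_single when_def 4 del: One_nat_def)
      moreover have "g $ b $ a = c a * (1 when b = w a)"
        by (simp add: g(1) mon_mat_def when_def)
      ultimately show ?thesis by simp
    qed
    then show "g = h" using gh by (simp add: vec_eq_iff)
  qed
  fix i j :: 'n and k :: "'n \<Rightarrow>\<^sub>0 nat" assume "consecutive i j"
  moreover have "perm_exp (Transposition.transpose i j) k = Poly_Mapping.map_key (Transposition.transpose i j) k"
    by (simp add: perm_exp_def)
  ultimately show "?A (swap_mat i j) (exp_monom k) =
    sscale (\<epsilon> ^ (Poly_Mapping.lookup k i * Poly_Mapping.lookup k j))
      (exp_monom (Poly_Mapping.map_key (Transposition.transpose i j) k))"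
    by (simp add: swap_mat_def perm_mat_eq explicit_action_monom inv_sign_consecutive mono_coeff_def)
next
  fix j :: 'n and \<zeta> :: complex and k :: "'n \<Rightarrow>\<^sub>0 nat" assume "\<zeta> \<noteq> 0"
  moreover have "perm_exp id k = k" by (rule poly_mapping_eqI) (simp add: lookup_perm_exp)
  ultimately show "explicit_action \<epsilon> (torus_mat j \<zeta>) (exp_monom k) = sscale (\<zeta> ^ Poly_Mapping.lookup k j) (exp_monom k)"
    by (simp add: torus_mat_def diag_mat_eq explicit_action_monom mono_coeff_def if_distrib[of "\<lambda>x. x ^ _"] 
        if_distribR prod.delta cong: if_cong)
qed


subsection \<open>Generators\<close>

lemma torus_mats_generate:
  assumes mult: "\<And>g h. P g \<Longrightarrow> P h \<Longrightarrow> P (g ** h)" and one: "P (mat 1)"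
    and torus: "\<And>j \<zeta>. \<zeta> \<noteq> 0 \<Longrightarrow> P (torus_mat j \<zeta>)"
    and t: "\<forall>i. t i \<noteq> 0"
  shows "P (diag_mat (t :: 'n::finite \<Rightarrow> complex))"
proof -
  have "P (diag_mat (\<lambda>i. if i \<in> A then t i else 1))" if "finite A" for A
    using that
  proof (induction A rule: finite_induct)
    case empty
    have "diag_mat (\<lambda>i. 1) = (mat 1 :: 'n cmat)" by (simp add: diag_mat_eq mat_1_eq)
    then show ?case using one by simp
  next
    case (insert a A)
    have "diag_mat (\<lambda>i. if i \<in> insert a A then t i else 1)
        = torus_mat a (t a) ** diag_mat (\<lambda>i. if i \<in> A then t i else 1)"
      using insert unfolding torus_mat_def diag_mat_eq mon_mat_mult
      by (intro arg_cong2[of _ _ _ _ mon_mat]) auto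
    then show ?case using insert torus t mult by simp
  qed
  from this[of UNIV] show ?thesis by simp
qed

lemma strict_mono_finite_id:
  fixes w :: "'n::{finite,linorder} \<Rightarrow> 'n"
  assumes "strict_mono w" shows "w = id"
proof
  fix x
  show "w x = id x"
  proof (rule ccontr)
    assume ne: "w x \<noteq> id x"
    have inj: "inj (\<lambda>k. (w ^^ k) x)"
    proof (cases "x < w x")
      case True
      have "(w ^^ k) x < (w ^^ Suc k) x" for k
        by (induction k) (use True assms in \<open>auto simp: strict_mono_less\<close>)
      then have "strict_mono (\<lambda>k. (w ^^ k) x)" by (simp add: strict_mono_Suc_iff)
      then show ?thesis by (rule strict_mono_imp_inj_on)
    next
      case False
      with ne have "w x < x" by auto
      then have "(w ^^ Suc k) x < (w ^^ k) x" for k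
        by (induction k) (use assms in \<open>auto simp: strict_mono_less\<close>)
      then have *: "(w ^^ l) x < (w ^^ k) x" if "k < l" for k l
        using that by (induction l) (auto simp: less_Suc_eq intro: less_trans)
      have "(w ^^ k) x \<noteq> (w ^^ l) x" if "k \<noteq> l" for k l
        using that * [of k l] * [of l k] by (cases "k < l") auto
      then show ?thesis unfolding inj_def by blast
    qed
    have "finite (UNIV :: nat set)" by (rule finite_imageD[OF _ inj]) simp
    then show False by simp
  qed
qed


lemma swap_mats_generate:
  fixes w :: "'n::{finite,linorder} \<Rightarrow> 'n"
  assumes mult: "\<And>g h. P g \<Longrightarrow> P h \<Longrightarrow> P (g ** h)" and one: "P (mat 1)"
    and swap: "\<And>i j. consecutive i j \<Longrightarrow> P (swap_mat i j)"
    and w: "bij w"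
  shows "P (perm_mat w)"
proof -
  define I where "I = (\<lambda>w :: 'n \<Rightarrow> 'n. {(a, b). a < b \<and> w b < w a})"
  from w show ?thesis
  proof (induction "card (I w)" arbitrary: w rule: less_induct)
    case less
    show ?case
    proof (cases "\<exists>i j. consecutive i j \<and> w j < w i")
      case False
      have "w a < w b" if "a < b" for a b
        using that
      proof (induction "card {a<..<b}" arbitrary: a b rule: less_induct)
        case (less a b)
        show ?case
        proof (cases "{a<..<b} = {}")
          case True
          with less have "consecutive a b" by (simp add: consecutive_def)
          with False have "\<not> w b < w a" by blast
          moreover have "w a \<noteq> w b" using \<open>bij w\<close> less.prems by (auto simp: bij_def inj_eq)
          ultimately show ?thesis by simp
        next
          case False
          then obtain c where c: "a < c" "c < b" by auto
          have "w a < w c" using c by (intro less.hyps psubset_card_mono) auto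
          also have "w c < w b" using c by (intro less.hyps psubset_card_mono) auto
          finally show ?thesis .
        qed
      qed
      then have "w = id" by (intro strict_mono_finite_id strict_monoI)
      then show ?thesis using one by (simp add: perm_mat_eq mat_1_eq)
    next
      case True
      then obtain i j where ij: "consecutive i j" "w j < w i" by auto
      let ?t = "Transposition.transpose i j"
      have ij': "i < j" using ij(1) by (simp add: consecutive_def)
      have "map_prod ?t ?t ` I (w \<circ> ?t) \<subseteq> I w - {(i, j)}"
      proof
        fix x assume "x \<in> map_prod ?t ?t ` I (w \<circ> ?t)"
        then obtain a b where x: "x = (?t a, ?t b)" and ab: "a < b" "w (?t b) < w (?t a)"
          by (auto simp: I_def)
        from ab(2) have "\<not> (a = i \<and> b = j)" using ij by auto
        then have "?t a \<le> ?t b"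
          using transpose_consecutive_less[OF ij(1) ab(1)] by (metis not_less)
        with ab have "x \<in> I w" by (auto simp: x I_def order.order_iff_strict)
        moreover have "x \<noteq> (i, j)"
          using ab(1) ij' by (auto simp: x Transposition.transpose_def split: if_splits)
        ultimately show "x \<in> I w - {(i, j)}" by simp
      qed
      moreover have "inj_on (map_prod ?t ?t) (I (w \<circ> ?t))"
        by (rule inj_on_subset[of _ UNIV]) (auto intro!: prod.inj_map)
      ultimately have "card (I (w \<circ> ?t)) \<le> card (I w - {(i, j)})"
        by (intro card_inj_on_le) auto
      also have "\<dots> < card (I w)"
        using ij ij' by (intro psubset_card_mono) (auto simp: I_def)
      finally have "P (perm_mat (w \<circ> ?t))"
        using less by (auto simp: bij_comp)
      then have "P (perm_mat (w \<circ> ?t) ** swap_mat i j)"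
        using mult swap ij by blast
      moreover have "perm_mat (w \<circ> ?t) ** swap_mat i j = perm_mat w"
        by (simp add: swap_mat_def perm_mat_eq mon_mat_mult o_assoc[symmetric])
      ultimately show ?thesis by simp
    qed
  qed
qed

lemma is_triangle_action_unique:
  assumes a: "is_triangle_action \<epsilon> act" and b: "is_triangle_action \<epsilon> act'"
    and g: "g \<in> carrier monomial_group"
  shows "act g = act' g"
proof -
  define P where "P = (\<lambda>g. g \<in> carrier monomial_group \<and> act g = act' g)"
  from a have la: "Vector_Spaces.linear sscale sscale (act g)" if "g \<in> carrier monomial_group" for g
    using that unfolding is_triangle_action_def faithful_linear_action_def by blast
  from b have lb: "Vector_Spaces.linear sscale sscale (act' g)" if "g \<in> carrier monomial_group" for g
    using that unfolding is_triangle_action_def faithful_linear_action_def by blast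
  have one: "P (mat 1)"
    using a b group.is_monoid[OF group_monomial_group, THEN monoid.one_closed]
    unfolding P_def is_triangle_action_def faithful_linear_action_def by auto
  have mult: "P (g ** h)" if "P g" "P h" for g h
    using a b that monoid.m_closed[OF group.is_monoid[OF group_monomial_group], of g h]
    unfolding P_def is_triangle_action_def faithful_linear_action_def by auto
  have swap: "P (swap_mat i j)" if "consecutive i j" for i j
  proof -
    have "swap_mat i j \<in> carrier monomial_group"
      unfolding swap_mat_def perm_mat_eq by (rule mon_mat_carrier) auto
    then show ?thesis
      unfolding P_def using a b that
      by (auto intro!: linear_eq_on_monom la lb simp: is_triangle_action_def)
  qed
  have torus: "P (torus_mat j \<zeta>)" if "\<zeta> \<noteq> 0" for j \<zeta>
  proof -
    have "torus_mat j \<zeta> \<in> carrier monomial_group"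
      unfolding torus_mat_def diag_mat_eq using that by (intro mon_mat_carrier) auto
    then show ?thesis
      unfolding P_def using a b that
      by (auto intro!: linear_eq_on_monom la lb simp: is_triangle_action_def)
  qed
  from g obtain t w where g': "g = diag_mat t ** perm_mat w" "\<forall>i. t i \<noteq> 0" "bij w"
    by (auto simp: monomial_group_def)
  have "P (diag_mat t)" using mult one torus g'(2) by (rule torus_mats_generate[of P])
  moreover have "P (perm_mat w)" using mult one swap g'(3) by (rule swap_mats_generate[of P])
  ultimately have "P g" using mult g'(1) by blast
  then show ?thesis by (simp add: P_def)
qed

theorem triangle_action_ex1:
  assumes "\<epsilon>\<^sup>2 = 1"
  shows "\<exists>!act :: ('n::{finite,linorder}) cmat \<Rightarrow> _.
    is_triangle_action \<epsilon> act \<and> act \<in> extensional (carrier monomial_group)"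
proof (rule ex1I)
  show "is_triangle_action \<epsilon> (explicit_action \<epsilon> :: 'n cmat \<Rightarrow> _) \<and>
      explicit_action \<epsilon> \<in> extensional (carrier (monomial_group :: 'n cmat monoid))"
    using is_triangle_action_explicit[OF assms] by (auto simp: explicit_action_def)
  fix act :: "'n cmat \<Rightarrow> _"
  assume act: "is_triangle_action \<epsilon> act \<and> act \<in> extensional (carrier monomial_group)"
  show "act = explicit_action \<epsilon>"
  proof (rule extensionalityI)
    show "act \<in> extensional (carrier monomial_group)" using act by simp
    show "explicit_action \<epsilon> \<in> extensional (carrier (monomial_group :: 'n cmat monoid))"
      by (auto simp: explicit_action_def)
    show "act g = explicit_action \<epsilon> g" if "g \<in> carrier monomial_group" for g
      using act is_triangle_action_explicit[OF assms] that by (blast intro: is_triangle_action_unique)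
  qed
qed

lemma triangle_action_eq_explicit:
  assumes "\<epsilon>\<^sup>2 = 1"
  shows "triangle_action \<epsilon> = explicit_action \<epsilon>"
  unfolding triangle_action_def
  using is_triangle_action_explicit[OF assms]
  by (intro the1_equality triangle_action_ex1[OF assms]) (auto simp: explicit_action_def)

end

(* Fix a permutation w and an exponent vector k.  Its contribution to the sum over W_{C,C'} is
   sum_c c^k times the inversion sign of (w, k), where c runs over the elements of C^n with
   det(c) sgn(w) in C'.  Multiplying one coordinate c_a by sgn(w) turns this into
   sgn(w)^(k_a) times the sum over det(c) in C'.  If the latter sum is nonzero, the character
   c |-> c^k is trivial on {det(c) in C'}; testing it on diagonal matrices with two entries -1 shows
   that all k_a have the same parity, and then the inversion sign is sgn(w)^(k_a).
   So the two group sums agree.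
   Uniqueness holds because the operators of distinct monomial matrices are linearly
   independent, so that a finite set of matrices is determined by the sum of its operators. *)

theory Submission
  imports Defs
begin

section \<open>Finite subgroups of the multiplicative group of nonzero complex numbers\<close>

lemma group_complex_units: "group complex_units"
  by (rule groupI) (auto simp: complex_units_def intro!: bexI[of _ "inverse _"])

lemma inv_complex_units: "z \<noteq> 0 \<Longrightarrow> inv\<^bsub>complex_units\<^esub> z = inverse z"
  by (rule group.inv_equality[OF group_complex_units]) (auto simp: complex_units_def)

lemma subgroup_complex_unitsD:
  assumes "subgroup H complex_units"
  shows "z \<in> H \<Longrightarrow> z \<noteq> 0" "1 \<in> H" "z \<in> H \<Longrightarrow> y \<in> H \<Longrightarrow> z * y \<in> H" "z \<in> H \<Longrightarrow> inverse z \<in> H"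
proof -
  show nz: "z \<noteq> 0" if "z \<in> H" for z
    using subgroup.subset[OF assms] that by (auto simp: complex_units_def)
  show "1 \<in> H" using subgroup.one_closed[OF assms] by (simp add: complex_units_def)
  show "z * y \<in> H" if "z \<in> H" "y \<in> H"
    using subgroup.m_closed[OF assms that] by (simp add: complex_units_def)
  show "inverse z \<in> H" if "z \<in> H"
    using subgroup.m_inv_closed[OF assms that] nz[OF that] by (simp add: inv_complex_units)
qed

text \<open>Multiplication by \<open>z\<close> permutes \<open>C\<close>, so comparing the products
  of all elements gives \<open>z ^ card C = 1\<close>. By counting, \<open>C\<close> is then the
  full set of roots of unity of order dividing \<open>card C\<close>, and \<open>-1\<close> is one
  of them.\<close>

lemma minus_one_mem_subgroup:
  assumes C: "subgroup C complex_units" and fin: "finite C" and even: "even (card C)"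
  shows "-1 \<in> C"
proof -
  note D = subgroup_complex_unitsD[OF C]
  have pos: "card C > 0" using fin D(2) by (auto simp: card_gt_0_iff)
  have "z ^ card C = 1" if "z \<in> C" for z
  proof -
    have "bij_betw ((*) z) C C"
      by (rule bij_betw_byWitness[of _ "(*) (inverse z)"]) (use that D in auto)
    then have "(\<Prod>y\<in>C. y) = (\<Prod>y\<in>C. z * y)"
      by (rule prod.reindex_bij_betw[symmetric])
    also have "\<dots> = z ^ card C * (\<Prod>y\<in>C. y)" by (simp add: prod.distrib)
    finally show ?thesis using D(1) fin by auto
  qed
  then have "C \<subseteq> {z. z ^ card C = 1}" by blast
  moreover have "card {z::complex. z ^ card C = 1} = card C"
    using pos by (rule card_roots_unity_eq)
  ultimately have "C = {z. z ^ card C = 1}"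
    using pos by (intro card_subset_eq) (auto intro: card_ge_0_finite)
  moreover have "(-1::complex) ^ card C = 1" using even by simp
  ultimately show ?thesis by blast
qed


section \<open>Signs\<close>

lemma det_swap_mat:
  assumes "i \<noteq> j"
  shows "det (swap_mat i j) = -1"
proof -
  let ?t = "Transposition.transpose i j"
  have "swap_mat i j = (\<chi> a. (mat 1 :: 'a cmat) $ ?t a)"
    unfolding swap_mat_def perm_mat_def mat_def
    by (auto simp: vec_eq_iff Transposition.transpose_def)
  moreover have "?t permutes UNIV" by (simp add: permutes_swap_id)
  ultimately show ?thesis
    using assms by (simp add: det_permute_rows sign_swap_id)
qed

lemma perm_mat_comp: "perm_mat v ** perm_mat w = perm_mat (v \<circ> w)"
  by (simp add: perm_mat_eq mon_mat_mult)

lemma perm_mat_id: "perm_mat id = mat 1"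
  by (simp add: perm_mat_eq mat_1_eq)

text \<open>Having a determinant of square \<open>1\<close> passes to products and holds for the
  consecutive swaps, which generate all permutation matrices.\<close>

lemma det_perm_mat_square:
  fixes w :: "'n::{finite,linorder} \<Rightarrow> 'n"
  assumes "bij w"
  shows "det (perm_mat w) * det (perm_mat w) = 1"
  by (rule swap_mats_generate[OF _ _ _ assms])
     (auto simp: det_mul det_swap_mat consecutive_def algebra_simps)

lemma perm_mat_inject:
  assumes "perm_mat v = perm_mat w"
  shows "v = w"
  using arg_cong[OF assms, of col_perm] by (simp add: perm_mat_eq)

text \<open>With odd exponents every inversion of \<open>w\<close> contributes \<open>-1\<close>, so
  the product is the usual sign of \<open>w\<close>.\<close>

lemma inv_sign_odd:
  fixes w :: "'n::{finite,linorder} \<Rightarrow> 'n"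
  assumes w: "bij w" and odd: "\<And>a. odd (Poly_Mapping.lookup k a)"
  shows "inv_sign (-1) w k = det (perm_mat w)"
proof -
  \<comment> \<open>\<open>swap_mats_generate\<close> speaks of matrices, hence the existential
    \<open>w\<close>, recovered at the end by \<open>perm_mat_inject\<close>. Quantifying over
    \<open>k\<close> is needed because \<open>inv_sign_comp\<close> evaluates the left factor at
    \<open>perm_exp w k\<close>.\<close>
  define P where "P g \<longleftrightarrow> (\<exists>w. bij w \<and> g = perm_mat w \<and>
    (\<forall>k. (\<forall>a. odd (Poly_Mapping.lookup k a)) \<longrightarrow> inv_sign (-1) w k = det g))" for g :: "'n cmat"
  have "P (perm_mat w)"
  proof (rule swap_mats_generate[OF _ _ _ w])
    fix g h assume "P g" "P h"
    then obtain v w where v: "bij v" "g = perm_mat v"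
        "\<And>k. \<forall>a. odd (Poly_Mapping.lookup k a) \<Longrightarrow> inv_sign (-1) v k = det g"
      and w: "bij w" "h = perm_mat w"
        "\<And>k. \<forall>a. odd (Poly_Mapping.lookup k a) \<Longrightarrow> inv_sign (-1) w k = det h"
      unfolding P_def by blast
    have "inv_sign (-1) (v \<circ> w) k = det (g ** h)" if "\<forall>a. odd (Poly_Mapping.lookup k a)" for k
      using that by (simp add: inv_sign_comp v(1,3) w(1,3) det_mul lookup_perm_exp)
    then show "P (g ** h)"
      unfolding P_def using v w by (intro exI[of _ "v \<circ> w"]) (auto simp: perm_mat_comp bij_comp)
  next
    show "P (mat 1)"
      unfolding P_def by (intro exI[of _ id]) (simp add: perm_mat_id)
  next
    fix i j :: 'n assume ij: "consecutive i j"
    then have "i \<noteq> j" by (auto simp: consecutive_def)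
    then show "P (swap_mat i j)"
      unfolding P_def
      by (intro exI[of _ "Transposition.transpose i j"])
         (simp add: swap_mat_def[symmetric] det_swap_mat inv_sign_consecutive[OF ij])
  qed
  then show ?thesis unfolding P_def using odd by (auto dest: perm_mat_inject)
qed

text \<open>If all exponents are even, both factors are \<open>1\<close>; if all are odd, both equal
  \<open>det (perm_mat w)\<close>, whose square is \<open>1\<close>.\<close>

lemma inv_sign_same_parity:
  fixes w :: "'n::{finite,linorder} \<Rightarrow> 'n"
  assumes w: "bij w"
    and parity: "\<And>b. even (Poly_Mapping.lookup k b) \<longleftrightarrow> even (Poly_Mapping.lookup k a)"
  shows "det (perm_mat w) ^ Poly_Mapping.lookup k a * inv_sign (-1) w k = 1"
proof (cases "even (Poly_Mapping.lookup k a)")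
  case True
  then have "even (Poly_Mapping.lookup k b)" for b using parity by blast
  then have "inv_sign (-1) w k = 1"
    unfolding inv_sign_def by (intro prod.neutral) auto
  moreover obtain l where "Poly_Mapping.lookup k a = 2 * l" using True by auto
  ultimately show ?thesis
    by (simp add: power_mult power2_eq_square det_perm_mat_square[OF w])
next
  case False
  then obtain l where l: "Poly_Mapping.lookup k a = 2 * l + 1" by (auto elim: oddE)
  have "inv_sign (-1) w k = det (perm_mat w)"
    using False parity by (intro inv_sign_odd[OF w]) blast
  then show ?thesis
    by (simp add: l power_add power_mult power2_eq_square det_perm_mat_square[OF w])
qed

lemma inv_sign_one [simp]: "inv_sign 1 w k = 1"
  unfolding inv_sign_def by (auto intro!: prod.neutral)

lemma inv_sign_nonzero: "\<epsilon> \<noteq> 0 \<Longrightarrow> inv_sign \<epsilon> w k \<noteq> 0"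
  unfolding inv_sign_def by (auto split: if_splits)


section \<open>Linear independence of the operators\<close>

lemma lookup_Abs_finite [simp]:
  "Poly_Mapping.lookup (Abs_poly_mapping (f :: 'n::finite \<Rightarrow> nat)) = f"
  by (simp add: Abs_poly_mapping_inverse)

text \<open>The shifts \<open>rank i * Suc D\<close> move the exponents of the different variables
  into disjoint intervals, so that only exponent vectors with distinct entries occur.\<close>

lemma separating_polynomial:
  fixes F :: "('n::{finite,linorder} \<Rightarrow> complex) set"
  assumes "finite F" and c0: "\<forall>i. c0 i \<noteq> 0"
  obtains K :: "('n \<Rightarrow>\<^sub>0 nat) set" and u :: "('n \<Rightarrow>\<^sub>0 nat) \<Rightarrow> complex"
  where "\<And>k. k \<in> K \<Longrightarrow> inj (Poly_Mapping.lookup k)"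
    and "(\<Sum>k\<in>K. u k * mono_coeff c0 k) \<noteq> 0"
    and "\<And>c. c \<in> F \<Longrightarrow> c \<noteq> c0 \<Longrightarrow> (\<Sum>k\<in>K. u k * mono_coeff c k) = 0"
proof -
  \<comment> \<open>\<open>q i\<close> vanishes at the \<open>i\<close>-th entries of the members of
    \<open>F\<close>, except at \<open>c0 i\<close>. A member other than \<open>c0\<close> differs
    from it in some coordinate, so the product of the \<open>q i\<close> over all coordinates
    vanishes there.\<close>
  define q where "q i = (\<Prod>z\<in>(\<lambda>c. c i) ` F - {c0 i}. [:-z, 1:])" for i
  define D where "D = Max (range (\<lambda>i. degree (q i)))"
  have deg: "degree (q i) \<le> D" for i unfolding D_def by (intro Max_ge) auto
  have poly: "poly (q i) z = (\<Sum>l\<le>D. coeff (q i) l * z ^ l)" for i z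
    unfolding poly_altdef using deg[of i]
    by (intro sum.mono_neutral_left) (auto simp: coeff_eq_0)
  define e where "e i = card {..<i} * Suc D" for i :: 'n
  define exps where "exps r = Abs_poly_mapping (\<lambda>i. e i + r i)" for r :: "'n \<Rightarrow> nat"
  define R where "R = (UNIV :: 'n set) \<rightarrow>\<^sub>E {..D}"
  define v where "v r = (\<Prod>i\<in>UNIV. coeff (q i) (r i))" for r
  have lk: "Poly_Mapping.lookup (exps r) i = e i + r i" for r i by (simp add: exps_def)
  have inj_exps: "inj_on exps R"
  proof (rule inj_onI)
    fix r s assume "exps r = exps s"
    then have "r i = s i" for i using lk[of r i] lk[of s i] by simp
    then show "r = s" by blast
  qed
  have distinct: "inj (Poly_Mapping.lookup (exps r))" if "r \<in> R" for r
  proof (rule linorder_inj_onI)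
    fix i j :: 'n assume "i < j"
    then have "card {..<i} < card {..<j}" by (intro psubset_card_mono) auto
    then have "(card {..<i} + 1) * Suc D \<le> card {..<j} * Suc D" by (intro mult_right_mono) auto
    moreover have "r i \<le> D" using that by (auto simp: R_def PiE_iff)
    ultimately have "e i + r i < e j" by (simp add: e_def)
    then show "Poly_Mapping.lookup (exps r) i \<noteq> Poly_Mapping.lookup (exps r) j" by (simp add: lk)
  qed auto
  \<comment> \<open>The coefficients \<open>v\<close> are indexed by \<open>r\<close>; by
    \<open>inj_exps\<close> they can be indexed by exponent vectors instead.\<close>
  define u where "u k = v (inv_into R exps k)" for k
  have eval: "(\<Sum>k\<in>exps ` R. u k * mono_coeff c k) = (\<Prod>i\<in>UNIV. c i ^ e i * poly (q i) (c i))" for c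
  proof -
    have "(\<Sum>k\<in>exps ` R. u k * mono_coeff c k) = (\<Sum>r\<in>R. v r * mono_coeff c (exps r))"
      by (simp add: sum.reindex[OF inj_exps] u_def inv_into_f_f[OF inj_exps])
    also have "\<dots> = (\<Sum>r\<in>R. \<Prod>i\<in>UNIV. c i ^ e i * (coeff (q i) (r i) * c i ^ r i))"
      by (simp add: v_def mono_coeff_def lk power_add prod.distrib[symmetric] mult_ac)
    also have "\<dots> = (\<Prod>i\<in>UNIV. \<Sum>l\<le>D. c i ^ e i * (coeff (q i) l * c i ^ l))"
      unfolding R_def by (rule prod_sum_PiE[symmetric]) auto
    also have "\<dots> = (\<Prod>i\<in>UNIV. c i ^ e i * poly (q i) (c i))"
      by (simp add: poly sum_distrib_left)
    finally show ?thesis .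
  qed
  have root: "poly (q i) z = 0 \<longleftrightarrow> z \<in> (\<lambda>c. c i) ` F - {c0 i}" for i z
    using assms(1) by (auto simp: q_def poly_prod)
  show ?thesis
  proof
    show "inj (Poly_Mapping.lookup k)" if "k \<in> exps ` R" for k using that distinct by auto
    \<comment> \<open>The monomial factors \<open>c0 i ^ e i\<close> that come from the shifts are
      nonzero because \<open>c0\<close> has no zero entry.\<close>
    show "(\<Sum>k\<in>exps ` R. u k * mono_coeff c0 k) \<noteq> 0"
      using c0 by (simp add: eval root)
    show "(\<Sum>k\<in>exps ` R. u k * mono_coeff c k) = 0" if "c \<in> F" "c \<noteq> c0" for c
    proof -
      from that(2) obtain i where "c i \<noteq> c0 i" by blast
      with that(1) have "poly (q i) (c i) = 0" by (auto simp: root)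
      then show ?thesis unfolding eval by (auto intro!: bexI[of _ i])
    qed
  qed
qed

text \<open>Distinct exponents let the permutation be read off from the image monomial.\<close>

lemma perm_exp_eq_iff:
  assumes "inj (Poly_Mapping.lookup k)" "bij v" "bij w"
  shows "perm_exp v k = perm_exp w k \<longleftrightarrow> v = w"
proof
  assume eq: "perm_exp v k = perm_exp w k"
  have "finv v a = finv w a" for a
    using arg_cong[OF eq, of "\<lambda>p. Poly_Mapping.lookup p a"] assms
    by (simp add: lookup_perm_exp inj_eq)
  then have "finv v = finv w" ..
  then show "v = w" using assms by (metis inv_inv_eq)
qed simp

text \<open>Different permutations are separated by the image of a monomial with distinct exponents,
  and different column coefficients for one permutation by the polynomial of
  \<open>separating_polynomial\<close>.\<close>

lemma explicit_action_independent:
  fixes A :: "('n::{finite,linorder}) cmat set"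
  assumes A: "finite A" "A \<subseteq> carrier monomial_group" and e: "\<epsilon> \<noteq> 0"
    and zero: "\<And>k. (\<Sum>g\<in>A. sscale (a g) (explicit_action \<epsilon> g (exp_monom k))) = 0"
    and g: "g \<in> A"
  shows "a g = 0"
proof -
  from A g obtain c0 w0 where g0: "g = mon_mat c0 w0" "\<forall>i. c0 i \<noteq> 0" "bij w0"
    unfolding carrier_monomial_group by blast
  let ?B = "{h \<in> A. col_perm h = w0}"
  have B: "finite ?B" using A by simp
  obtain K u where K: "\<And>k. k \<in> K \<Longrightarrow> inj (Poly_Mapping.lookup k)"
    and nz: "(\<Sum>k\<in>K. u k * mono_coeff c0 k) \<noteq> 0"
    and z: "\<And>c. c \<in> col_entry ` ?B \<Longrightarrow> c \<noteq> c0 \<Longrightarrow> (\<Sum>k\<in>K. u k * mono_coeff c k) = 0"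
    using separating_polynomial[of "col_entry ` ?B" c0] B g0(2) by blast
  have coeff: "(\<Sum>h\<in>?B. a h * mono_coeff (col_entry h) k) = 0" if k: "k \<in> K" for k
  proof -
    \<comment> \<open>Only matrices with permutation \<open>w0\<close> reach the monomial
      \<open>perm_exp w0 k\<close>. Their inversion sign is a common nonzero factor, which is
      cancelled below.\<close>
    have "Poly_Mapping.lookup (sscale (a h) (explicit_action \<epsilon> h (exp_monom k))) (perm_exp w0 k)
        = (if col_perm h = w0 then inv_sign \<epsilon> w0 k * (a h * mono_coeff (col_entry h) k) else 0)"
      if "h \<in> A" for h
    proof -
      from A that obtain c w where h: "h = mon_mat c w" "\<forall>i. c i \<noteq> 0" "bij w"
        unfolding carrier_monomial_group by blast
      then show ?thesis
        unfolding h(1) explicit_action_monom[OF h(2,3)]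
        by (simp add: exp_monom_def lookup_single when_def perm_exp_eq_iff[OF K[OF k]] g0)
    qed
    then have "(\<Sum>h\<in>A. if col_perm h = w0
        then inv_sign \<epsilon> w0 k * (a h * mono_coeff (col_entry h) k) else 0) = 0"
      using arg_cong[OF zero[of k], of "\<lambda>p. Poly_Mapping.lookup p (perm_exp w0 k)"]
      by (simp add: lookup_sum)
    then have "inv_sign \<epsilon> w0 k * (\<Sum>h\<in>?B. a h * mono_coeff (col_entry h) k) = 0"
      using A(1)
      by (simp add: sum.inter_filter sum_distrib_left if_distrib[of "(*) _"] cong: if_cong)
    then show ?thesis by (simp add: inv_sign_nonzero e)
  qed
  have g_unique: "h = g" if "h \<in> ?B" "col_entry h = c0" for h
    using that A(2) g0 unfolding carrier_monomial_group by fastforce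
  \<comment> \<open>Weighting the relations \<open>coeff\<close> by \<open>u\<close> and exchanging
    the sums leaves only the term of \<open>g\<close>.\<close>
  have "0 = (\<Sum>k\<in>K. u k * (\<Sum>h\<in>?B. a h * mono_coeff (col_entry h) k))"
    by (simp add: coeff)
  also have "\<dots> = (\<Sum>h\<in>?B. a h * (\<Sum>k\<in>K. u k * mono_coeff (col_entry h) k))"
    unfolding sum_distrib_left by (subst sum.swap) (simp add: mult_ac)
  also have "\<dots> = (\<Sum>h\<in>?B. if h = g then a g * (\<Sum>k\<in>K. u k * mono_coeff c0 k) else 0)"
  proof (intro sum.cong refl)
    fix h assume h: "h \<in> ?B"
    show "a h * (\<Sum>k\<in>K. u k * mono_coeff (col_entry h) k) =
        (if h = g then a g * (\<Sum>k\<in>K. u k * mono_coeff c0 k) else 0)"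
    proof (cases "col_entry h = c0")
      case True
      then show ?thesis using g_unique[OF h] by simp
    next
      case False
      then have "h \<noteq> g" using g0 by auto
      with z[of "col_entry h"] h False show ?thesis by simp
    qed
  qed
  also have "\<dots> = a g * (\<Sum>k\<in>K. u k * mono_coeff c0 k)"
    using B g g0 by simp
  finally show ?thesis using nz by simp
qed

text \<open>Independence is applied to the difference of the two indicator functions, which is
  nonzero exactly on the symmetric difference.\<close>

corollary explicit_action_sum_inject:
  fixes A B :: "('n::{finite,linorder}) cmat set"
  assumes A: "finite A" "A \<subseteq> carrier monomial_group"
    and B: "finite B" "B \<subseteq> carrier monomial_group" and e: "\<epsilon> \<noteq> 0"
    and eq: "\<And>k. (\<Sum>g\<in>A. explicit_action \<epsilon> g (exp_monom k)) = (\<Sum>g\<in>B. explicit_action \<epsilon> g (exp_monom k))"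
  shows "A = B"
proof -
  interpret vector_space sscale by (rule vector_space_sscale)
  define a :: "'n cmat \<Rightarrow> complex" where "a g = indicator A g - indicator B g" for g
  have "(\<Sum>g\<in>A \<union> B. sscale (a g) (explicit_action \<epsilon> g (exp_monom k))) = 0" for k
  proof -
    let ?f = "\<lambda>g. explicit_action \<epsilon> g (exp_monom k)"
    have "sscale (indicator X g) (?f g) = (if g \<in> X then ?f g else 0)" for X g
      by (simp add: indicator_def)
    then have "(\<Sum>g\<in>A \<union> B. sscale (indicator X g) (?f g)) = sum ?f X" if "X \<in> {A, B}" for X
      using A(1) B(1) that
      by (auto simp: sum.inter_restrict[symmetric] Int_absorb1 Int_absorb2 intro!: arg_cong[of _ _ "sum ?f"])
    then show ?thesis by (simp add: a_def scale_left_diff_distrib sum_subtractf eq)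
  qed
  then have "a g = 0" if "g \<in> A \<union> B" for g
    using A B e that by (intro explicit_action_independent[of "A \<union> B" \<epsilon> a g]) auto
  then have "g \<in> A \<longleftrightarrow> g \<in> B" for g
    by (cases "g \<in> A"; cases "g \<in> B") (force simp: a_def)+
  then show ?thesis by blast
qed


section \<open>The two families of groups\<close>

text \<open>The coefficients are indexed by columns, as in \<open>mon_mat\<close>; \<open>z\<close>
  will be the value of a character at the permutation.\<close>

definition torus_part :: "complex set \<Rightarrow> complex set \<Rightarrow> complex \<Rightarrow> ('n::finite \<Rightarrow> complex) set" where
  "torus_part C C' z = {c. (\<forall>i. c i \<in> C) \<and> prod c UNIV * z \<in> C'}"

text \<open>A common generalization of \<open>G_group\<close> (with \<open>\<sigma>\<close> trivial) and \<open>W_group\<close> (with \<open>\<sigma>\<close> the sign).\<close>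

definition twisted_group ::
    "(('n::finite \<Rightarrow> 'n) \<Rightarrow> complex) \<Rightarrow> complex set \<Rightarrow> complex set \<Rightarrow> 'n cmat set" where
  "twisted_group \<sigma> C C' = (\<lambda>(w, c). mon_mat c w) ` (SIGMA w:{w. bij w}. torus_part C C' (\<sigma> w))"

lemma prod_bij: "bij w \<Longrightarrow> (\<Prod>i\<in>UNIV. f (w i)) = prod f UNIV"
  by (rule prod.reindex_bij_betw)

lemma det_diag_mat: "det (diag_mat t) = prod t UNIV"
  by (subst det_diagonal) (auto simp: diag_mat_def)

text \<open>Passing from diagonal entries to column coefficients permutes them by \<open>w\<close>,
  which leaves their product unchanged.\<close>

lemma twisted_group_alt:
  "twisted_group \<sigma> C C' = {diag_mat t ** perm_mat w | t w.
     (\<forall>i. t i \<in> C) \<and> bij w \<and> det (diag_mat t) * \<sigma> w \<in> C'}" (is "_ = ?R")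
proof safe
  fix x assume "x \<in> twisted_group \<sigma> C C'"
  then obtain c w where cw: "x = mon_mat c w" "bij w" "\<forall>i. c i \<in> C" "prod c UNIV * \<sigma> w \<in> C'"
    by (auto simp: twisted_group_def torus_part_def)
  have "x = diag_mat (c \<circ> finv w) ** perm_mat w"
    using cw by (simp add: diag_perm_mat o_assoc[symmetric] bij_is_inj)
  moreover have "det (diag_mat (c \<circ> finv w)) = prod c UNIV"
    using prod_bij[OF bij_imp_bij_inv[OF cw(2)], of c] by (simp add: det_diag_mat)
  ultimately show "\<exists>t w. x = diag_mat t ** perm_mat w \<and> (\<forall>i. t i \<in> C) \<and> bij w \<and> det (diag_mat t) * \<sigma> w \<in> C'"
    using cw by (intro exI[of _ "c \<circ> finv w"] exI[of _ w]) auto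
next
  fix t :: "'a \<Rightarrow> complex" and w :: "'a \<Rightarrow> 'a" assume "\<forall>i. t i \<in> C" "bij w" "det (diag_mat t) * \<sigma> w \<in> C'"
  then have "t \<circ> w \<in> torus_part C C' (\<sigma> w)"
    using prod_bij[of w t] by (simp add: torus_part_def det_diag_mat)
  with \<open>bij w\<close> show "diag_mat t ** perm_mat w \<in> twisted_group \<sigma> C C'"
    by (auto simp: twisted_group_def diag_perm_mat intro!: image_eqI[of _ _ "(w, t \<circ> w)"])
qed

lemma G_group_twisted: "G_group C C' = twisted_group (\<lambda>_. 1) C C'"
  by (simp add: G_group_def twisted_group_alt)

lemma W_group_twisted: "W_group C C' = twisted_group (\<lambda>w. det (perm_mat w)) C C'"
  by (simp add: W_group_def twisted_group_alt det_mul)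

lemma finite_torus_part:
  assumes "finite C"
  shows "finite (torus_part C C' z)"
  by (rule finite_subset[OF _ finite_PiE[of UNIV "\<lambda>_. C"]]) (auto simp: torus_part_def assms)

lemma finite_twisted_group: "finite C \<Longrightarrow> finite (twisted_group \<sigma> C C')"
  unfolding twisted_group_def by (intro finite_imageI finite_SigmaI finite_torus_part) auto

lemma mon_mat_inject:
  assumes "mon_mat c v = mon_mat d w" "\<forall>i. c i \<noteq> 0" "\<forall>i. d i \<noteq> 0"
  shows "c = d" "v = w"
  using arg_cong[OF assms(1), of col_entry] arg_cong[OF assms(1), of col_perm] assms(2,3) by simp_all

text \<open>The value \<open>prod c UNIV * \<sigma> w\<close> is multiplicative in the matrix, and
  membership asks that it lie in the subgroup \<open>C'\<close>.\<close>

lemma subgroup_twisted_group: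
  fixes \<sigma> :: "('n::{finite,linorder} \<Rightarrow> 'n) \<Rightarrow> complex"
  assumes C: "subgroup C complex_units" and C': "subgroup C' complex_units"
    and one: "\<sigma> id = 1" and mult: "\<And>v w. bij v \<Longrightarrow> bij w \<Longrightarrow> \<sigma> (v \<circ> w) = \<sigma> v * \<sigma> w"
  shows "subgroup (twisted_group \<sigma> C C') monomial_group"
proof (rule group.subgroupI[OF group_monomial_group])
  note D = subgroup_complex_unitsD[OF C] and D' = subgroup_complex_unitsD[OF C']
  show sub: "twisted_group \<sigma> C C' \<subseteq> carrier monomial_group"
    using D(1) by (auto simp: twisted_group_def torus_part_def intro!: mon_mat_carrier)
  have "mat 1 \<in> twisted_group \<sigma> C C'"
    unfolding twisted_group_def mat_1_eq
    by (rule image_eqI[of _ _ "(id, \<lambda>_. 1)"]) (auto simp: torus_part_def D(2) D'(2) one)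
  then show "twisted_group \<sigma> C C' \<noteq> {}" by blast
  have prod_comp: "(\<Prod>j\<in>UNIV. c (v j) * d j) * \<sigma> (w \<circ> v) = (prod c UNIV * \<sigma> w) * (prod d UNIV * \<sigma> v)"
    if "bij v" "bij w" for c d v w
    using that by (simp add: prod.distrib prod_bij mult mult_ac)
  show "g \<otimes>\<^bsub>monomial_group\<^esub> h \<in> twisted_group \<sigma> C C'"
    if gh: "g \<in> twisted_group \<sigma> C C'" "h \<in> twisted_group \<sigma> C C'" for g h
  proof -
    obtain c w d v where *: "g = mon_mat c w" "h = mon_mat d v" "bij w" "bij v"
      "c \<in> torus_part C C' (\<sigma> w)" "d \<in> torus_part C C' (\<sigma> v)"
      using gh by (auto simp: twisted_group_def)
    then have "(\<lambda>j. c (v j) * d j) \<in> torus_part C C' (\<sigma> (w \<circ> v))"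
      unfolding torus_part_def mem_Collect_eq prod_comp[OF *(4,3)] by (auto intro: D(3) D'(3))
    with * show ?thesis
      by (auto simp: twisted_group_def mon_mat_mult bij_comp intro!: image_eqI[of _ _ "(w \<circ> v, \<lambda>j. c (v j) * d j)"])
  qed
  show "inv\<^bsub>monomial_group\<^esub> g \<in> twisted_group \<sigma> C C'" if g: "g \<in> twisted_group \<sigma> C C'" for g
  proof -
    obtain c w where cw: "g = mon_mat c w" "bij w" "c \<in> torus_part C C' (\<sigma> w)"
      using g by (auto simp: twisted_group_def)
    have nz: "\<forall>i. c i \<noteq> 0" using cw(3) D(1) by (auto simp: torus_part_def)
    have gc: "g \<in> carrier monomial_group" using sub g by blast
    \<comment> \<open>The form of the inverse is not guessed: its entries are solved from
      \<open>g\<close> times its inverse being \<open>mat 1\<close>.\<close>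
    obtain d v where dv: "inv\<^bsub>monomial_group\<^esub> g = mon_mat d v" "\<forall>i. d i \<noteq> 0" "bij v"
      using group.inv_closed[OF group_monomial_group gc] unfolding carrier_monomial_group by auto
    have "mon_mat (\<lambda>j. c (v j) * d j) (w \<circ> v) = mon_mat (\<lambda>_. 1) id"
      using group.r_inv[OF group_monomial_group gc, unfolded dv(1)]
      by (simp add: cw(1) mon_mat_mult mat_1_eq)
    from mon_mat_inject[OF this] nz dv(2)
    have cd: "(\<lambda>j. c (v j) * d j) = (\<lambda>_. 1)" and wv: "w \<circ> v = id" by auto
    have "d i = inverse (c (v i))" for i
      using fun_cong[OF cd, of i] by (metis inverse_unique)
    then have "\<forall>i. d i \<in> C" using cw(3) D(4) by (simp add: torus_part_def)
    moreover have "(prod c UNIV * \<sigma> w) * (prod d UNIV * \<sigma> v) = 1"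
      using prod_comp[OF dv(3) cw(2), of c d] unfolding cd wv one by simp
    then have "prod d UNIV * \<sigma> v = inverse (prod c UNIV * \<sigma> w)" by (metis inverse_unique)
    then have "prod d UNIV * \<sigma> v \<in> C'" using cw(3) D'(4) by (simp only:) (simp add: torus_part_def del: inverse_mult_distrib)
    ultimately show ?thesis
      using dv by (auto simp: twisted_group_def torus_part_def intro!: image_eqI[of _ _ "(v, d)"])
  qed
qed

text \<open>Matrices with the same permutation send a monomial to multiples of one monomial, so only
  the sum of their coefficients matters.\<close>

lemma sum_twisted_group:
  fixes \<sigma> :: "('n::{finite,linorder} \<Rightarrow> 'n) \<Rightarrow> complex"
  assumes fin: "finite C" and nz: "0 \<notin> C"
  shows "(\<Sum>g\<in>twisted_group \<sigma> C C'. explicit_action \<epsilon> g (exp_monom k)) =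
    (\<Sum>w | bij w. sscale ((\<Sum>c\<in>torus_part C C' (\<sigma> w). mono_coeff c k) * inv_sign \<epsilon> w k)
      (exp_monom (perm_exp w k)))"
proof -
  interpret vector_space sscale by (rule vector_space_sscale)
  have nz': "\<forall>i. c i \<noteq> 0" if "c \<in> torus_part C C' z" for c :: "'n \<Rightarrow> complex" and z
    using that nz by (auto simp: torus_part_def) metis
  have inj: "inj_on (\<lambda>(w, c). mon_mat c w) (SIGMA w:{w. bij w}. torus_part C C' (\<sigma> w))"
    by (rule inj_onI) (auto dest: nz' mon_mat_inject)
  have "(\<Sum>g\<in>twisted_group \<sigma> C C'. explicit_action \<epsilon> g (exp_monom k)) =
    (\<Sum>w | bij w. \<Sum>c\<in>torus_part C C' (\<sigma> w). explicit_action \<epsilon> (mon_mat c w) (exp_monom k))"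
    unfolding twisted_group_def
    by (subst sum.reindex[OF inj], subst sum.Sigma)
       (auto simp: finite_torus_part fin intro!: sum.cong)
  also have "\<dots> = (\<Sum>w | bij w. \<Sum>c\<in>torus_part C C' (\<sigma> w).
      sscale (mono_coeff c k * inv_sign \<epsilon> w k) (exp_monom (perm_exp w k)))"
    using nz' by (intro sum.cong refl) (auto simp: explicit_action_monom)
  finally show ?thesis by (simp add: scale_sum_left sum_distrib_right)
qed


section \<open>Character sums\<close>

text \<open>Substitute \<open>d i * c i\<close> for \<open>c i\<close>. This serves both to change
  the determinant condition and to test whether the character \<open>mono_coeff\<close> is
  trivial.\<close>

lemma sum_torus_part_shift:
  fixes d :: "'n::finite \<Rightarrow> complex"
  assumes C: "subgroup C complex_units" and d: "\<forall>i. d i \<in> C" and z: "z = y * prod d UNIV"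
  shows "(\<Sum>c\<in>torus_part C C' y. mono_coeff c k) = mono_coeff d k * (\<Sum>c\<in>torus_part C C' z. mono_coeff c k)"
proof -
  note D = subgroup_complex_unitsD[OF C]
  have nz: "\<forall>i. d i \<noteq> 0" using d D(1) by blast
  then have inv: "prod d UNIV * (\<Prod>i\<in>UNIV. inverse (d i)) = 1"
    by (simp flip: prod.distrib)
  have mono: "mono_coeff (\<lambda>i. d i * c i) k = mono_coeff d k * mono_coeff c k" for c
    by (simp add: mono_coeff_def power_mult_distrib prod.distrib)
  have "(\<Sum>c\<in>torus_part C C' y. mono_coeff c k) = (\<Sum>c\<in>torus_part C C' z. mono_coeff (\<lambda>i. d i * c i) k)"
    by (rule sum.reindex_bij_witness[of _ "\<lambda>c i. d i * c i" "\<lambda>c i. inverse (d i) * c i"])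
       (use nz d in \<open>auto simp: torus_part_def z prod.distrib inv D(3,4) mult_ac\<close>)
  then show ?thesis by (simp add: mono sum_distrib_left)
qed

lemma mono_coeff_upd:
  "mono_coeff (\<lambda>i. if i = a then z else 1) k = z ^ Poly_Mapping.lookup k a"
  by (simp add: mono_coeff_def if_distrib[of "\<lambda>x. x ^ _"] if_distribR prod.delta cong: if_cong)

lemma sum_torus_part_sign:
  fixes C C' :: "complex set" and w :: "'n::{finite,linorder} \<Rightarrow> 'n"
  assumes C: "subgroup C complex_units" and m1: "-1 \<in> C" and w: "bij w"
  shows "(\<Sum>c\<in>torus_part C C' (det (perm_mat w)). mono_coeff c k) * inv_sign (-1) w k =
    (\<Sum>c\<in>torus_part C C' 1. mono_coeff (c :: 'n \<Rightarrow> complex) k)" (is "?L * _ = ?R")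
proof -
  let ?s = "det (perm_mat w)"
  \<comment> \<open>Any coordinate will do; one exists because types are nonempty.\<close>
  obtain a :: 'n where True by blast
  have one: "1 \<in> C" using subgroup_complex_unitsD(2)[OF C] .
  have "(?s - 1) * (?s + 1) = 0" using det_perm_mat_square[OF w] by (simp add: algebra_simps)
  then have s: "?s = 1 \<or> ?s = -1" by (auto simp: add_eq_0_iff2)
  \<comment> \<open>Shift by the diagonal matrix with entry \<open>?s\<close> at \<open>a\<close>
    and \<open>1\<close> elsewhere; since \<open>?s * ?s = 1\<close>, the condition for
    \<open>?s\<close> becomes the one for \<open>1\<close>.\<close>
  have L: "?L = ?s ^ Poly_Mapping.lookup k a * ?R"
    unfolding mono_coeff_upd[symmetric]
    by (rule sum_torus_part_shift[OF C])
       (use s m1 one det_perm_mat_square[OF w] in \<open>auto simp: prod.delta\<close>)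
  show ?thesis
  proof (cases "?R = 0")
    case False
    have "even (Poly_Mapping.lookup k b) \<longleftrightarrow> even (Poly_Mapping.lookup k a)" for b
    proof -
      let ?d = "\<lambda>x i :: 'n. if i = x then -1 else (1::complex)"
      \<comment> \<open>Two sign changes, at \<open>b\<close> and then at \<open>a\<close>, lead
        from \<open>torus_part C C' 1\<close> through \<open>torus_part C C' (-1)\<close> and back,
        so \<open>-1\<close> need not lie in \<open>C'\<close>.\<close>
      have "?R = mono_coeff (?d b) k * (mono_coeff (?d a) k * ?R)"
        by (subst sum_torus_part_shift[OF C, of "?d b" "-1" 1])
           (use m1 one sum_torus_part_shift[OF C, of "?d a" 1 "-1"] in \<open>auto simp: prod.delta\<close>)
      with False have "(-1::complex) ^ Poly_Mapping.lookup k b * (-1) ^ Poly_Mapping.lookup k a = 1"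
        by (simp add: mono_coeff_upd)
      then show ?thesis by (auto simp: uminus_power_if split: if_splits)
    qed
    from inv_sign_same_parity[OF w this] show ?thesis
      unfolding L by (simp add: mult_ac)
  qed (simp add: L)
qed

text \<open>The two sums agree permutation by permutation; on the right the inversion sign is
  \<open>1\<close>.\<close>

lemma sum_W_group_eq_sum_G_group:
  fixes k :: "'n::{finite,linorder} \<Rightarrow>\<^sub>0 nat"
  assumes "subgroup C complex_units" "finite C" "-1 \<in> C"
  shows "(\<Sum>g\<in>W_group C C'. explicit_action (-1) g (exp_monom k)) =
    (\<Sum>g\<in>G_group C C'. explicit_action 1 g (exp_monom k))"
proof -
  have "0 \<notin> C" using subgroup_complex_unitsD(1)[OF assms(1)] by blast
  note sum = sum_twisted_group[OF assms(2) this]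
  show ?thesis
    unfolding W_group_twisted G_group_twisted sum
    by (intro sum.cong refl) (simp add: sum_torus_part_sign[OF assms(1,3)])
qed


section \<open>Mystical equivalence\<close>

lemma faithful_linear_action_subgroup:
  fixes H :: "('n::{finite,linorder}) cmat set"
  assumes H: "subgroup H monomial_group" and e: "\<epsilon>\<^sup>2 = 1"
  shows "faithful_linear_action sscale (monomial_group\<lparr>carrier := H\<rparr>) (explicit_action \<epsilon>)"
proof -
  have "faithful_linear_action sscale monomial_group (explicit_action \<epsilon> :: 'n cmat \<Rightarrow> _)"
    using is_triangle_action_explicit[OF e] unfolding is_triangle_action_def by (rule conjunct1)
  then show ?thesis
    using subgroup.subset[OF H] subgroup.subgroup_is_group[OF H group_monomial_group]
    unfolding faithful_linear_action_def by (auto intro: inj_on_subset)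
qed

lemma algebra_hom_group_sum:
  "algebra_hom sscale (monomial_group\<lparr>carrier := H\<rparr>) \<rho> (group_sum (monomial_group\<lparr>carrier := H\<rparr>))
    = (\<lambda>v. \<Sum>g\<in>H. \<rho> g v)"
proof -
  interpret vector_space sscale by (rule vector_space_sscale)
  show ?thesis by (simp add: algebra_hom_def group_sum_def)
qed

lemma linear_sum_explicit_action:
  assumes "H \<subseteq> carrier monomial_group"
  shows "Vector_Spaces.linear sscale sscale (\<lambda>v. \<Sum>g\<in>H. explicit_action \<epsilon> g v)"
proof -
  interpret vector_space_pair sscale sscale
    by (simp add: vector_space_pair_def vector_space_sscale)
  show ?thesis
    using assms by (intro linear_compose_sum ballI linear_explicit_action) auto
qed

text \<open>Faithfulness is inherited from the whole monomial group, and equality of the two linear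
  operators can be tested on monomials.\<close>

lemma is_mystic_partner_iff:
  fixes G M :: "('n::{finite,linorder}) cmat set"
  assumes G: "subgroup G monomial_group" "finite G"
  shows "is_mystic_partner G M \<longleftrightarrow> subgroup M monomial_group \<and> finite M \<and>
    (\<forall>k. (\<Sum>g\<in>M. explicit_action (-1) g (exp_monom k)) = (\<Sum>g\<in>G. explicit_action 1 g (exp_monom k)))"
proof -
  let ?L = "\<lambda>v. \<Sum>g\<in>M. explicit_action (-1) g v" and ?R = "\<lambda>v. \<Sum>g\<in>G. explicit_action 1 g v"
  have sums_eq: "?L = ?R \<longleftrightarrow> (\<forall>k. ?L (exp_monom k) = ?R (exp_monom k))"
    if M: "subgroup M monomial_group"
  proof
    assume eq: "?L = ?R"
    show "\<forall>k. ?L (exp_monom k) = ?R (exp_monom k)"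
      by (intro allI fun_cong[OF eq])
  next
    assume "\<forall>k. ?L (exp_monom k) = ?R (exp_monom k)"
    then show "?L = ?R"
      by (intro linear_eq_on_monom linear_sum_explicit_action
          subgroup.subset[OF M] subgroup.subset[OF G(1)]) blast
  qed
  have faithful: "faithful_linear_action sscale (monomial_group\<lparr>carrier := H\<rparr>) (explicit_action \<epsilon>)"
    if "subgroup H monomial_group" "\<epsilon> \<in> {1, -1}" for H :: "'n cmat set" and \<epsilon>
    by (rule faithful_linear_action_subgroup[OF that(1)]) (use that(2) in auto)
  have explicit: "triangle_plus = (explicit_action 1 :: 'n cmat \<Rightarrow> _)"
    "triangle_minus = (explicit_action (-1) :: 'n cmat \<Rightarrow> _)"
    by (rule triangle_action_eq_explicit; simp)+
  show ?thesis
  proof (cases "subgroup M monomial_group")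
    case True
    then show ?thesis
      unfolding is_mystic_partner_def mystically_equivalent_def explicit algebra_hom_group_sum sums_eq[OF True]
      using G faithful[OF True] faithful[OF G(1)] by simp
  qed (simp add: is_mystic_partner_def)
qed

theorem theorem2p5:
  fixes m p :: nat and C C' :: "complex set"
    and G :: "('n::{finite,linorder}) cmat set"
  assumes "m \<ge> 2" and "even m" and "p dvd m"
    and "subgroup C complex_units" and "card C = m"
    and "subgroup C' complex_units" and "card C' = m div p"
    and "G = G_group C C'"
  shows "(\<exists>!M. is_mystic_partner G M) \<and> mystic_partner G = W_group C C'"
proof -
  have fin: "finite C" using assms(1,5) by (intro card_ge_0_finite) simp
  \<comment> \<open>This is where the evenness of \<open>m\<close> enters.\<close>
  have m1: "-1 \<in> C" using assms(2,5) by (intro minus_one_mem_subgroup assms(4) fin) simp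
  have G: "subgroup G monomial_group" "finite G"
    unfolding assms(8) G_group_twisted
    by (rule subgroup_twisted_group[OF assms(4,6)], simp_all add: finite_twisted_group fin)
  have W: "subgroup (W_group C C' :: 'n cmat set) monomial_group" "finite (W_group C C' :: 'n cmat set)"
    unfolding W_group_twisted
    by (rule subgroup_twisted_group[OF assms(4,6)],
        simp_all add: finite_twisted_group fin perm_mat_id perm_mat_comp[symmetric] det_mul)
  note iff = is_mystic_partner_iff[OF G]
  have partner: "is_mystic_partner G (W_group C C')"
    unfolding iff unfolding assms(8)
    by (intro conjI allI W sum_W_group_eq_sum_G_group assms(4) fin m1)
  \<comment> \<open>Both \<open>M\<close> and \<open>W_group C C'\<close> have the operator sum of
    \<open>G\<close>, now for the same action, so independence of the operators identifies
    them.\<close>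
  have unique: "M = W_group C C'" if M: "is_mystic_partner G M" for M
  proof (rule explicit_action_sum_inject[of _ _ "-1"])
    show "(\<Sum>g\<in>M. explicit_action (-1) g (exp_monom k)) =
        (\<Sum>g\<in>W_group C C'. explicit_action (-1) g (exp_monom k))" for k
      using M partner unfolding iff by simp
    show "finite M" "M \<subseteq> carrier monomial_group"
      using M unfolding iff by (simp_all add: subgroup.subset)
  qed (simp_all add: W subgroup.subset)
  have "mystic_partner G = W_group C C'"
    unfolding mystic_partner_def using partner unique by (rule the_equality)
  with partner unique show ?thesis by blast
qed

end
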